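(* Let $r\ge2$, $2\le k\le r+1$ and $n\ge1$ be integers, and let $t=k-1$. Then \[ {\rm ex}(tn,H_k^r) \geq t^r\,{\rm ex}(n,H_k^r) + \frac{1}{n}\binom{tn}{r} - \frac{1}{n}\,t^r\binom{n}{r} - \frac{1}{2}\,t^{r-1}(t-1)\binom{n-1}{r-2}. \]
   Context: $H_k^r$ is the $r$-uniform hypergraph with $r+1$ vertices and $k$ edges ($k\le r+1$); ${\rm ex}(n,H)$ is the maximum number of edges in an $r$-uniform hypergraph on $n$ vertices with no subgraph isomorphic to $H$. *)

theory Defs
  imports Complex_Main
begin

datatype 'a hypergraph = Hypergraph (verts: "'a set") (edges: "'a set set")

definition uniform :: "nat \<Rightarrow> 'a hypergraph \<Rightarrow> bool" where
  "uniform r G \<longleftrightarrow> finite (verts G) \<and> (\<forall>e\<in>edges G. e \<subseteq> verts G \<and> card e = r)"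

definition subhypergraph :: "'a hypergraph \<Rightarrow> 'a hypergraph \<Rightarrow> bool" where
  "subhypergraph G' G \<longleftrightarrow>
     verts G' \<subseteq> verts G \<and> edges G' \<subseteq> edges G \<and> (\<forall>e\<in>edges G'. e \<subseteq> verts G')"

definition isomorphic :: "'a hypergraph \<Rightarrow> 'b hypergraph \<Rightarrow> bool" where
  "isomorphic G H \<longleftrightarrow>
     (\<exists>f. bij_betw f (verts G) (verts H) \<and> (\<lambda>e. f ` e) ` edges G = edges H)"

definition hfree :: "'b hypergraph \<Rightarrow> 'a hypergraph \<Rightarrow> bool" where
  "hfree H G \<longleftrightarrow> \<not> (\<exists>G'. subhypergraph G' G \<and> isomorphic G' H)"

text \<open>Every finite hypergraph is isomorphic to one with vertices in \<open>nat\<close>, so it is enough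
  to let \<open>G\<close> range over those. The maximum is over a nonempty set as soon as \<open>H\<close> has an edge.\<close>

definition ex :: "nat \<Rightarrow> nat \<Rightarrow> 'b hypergraph \<Rightarrow> nat" where
  "ex r n H =
     Max {card (edges G) | G :: nat hypergraph. uniform r G \<and> card (verts G) = n \<and> hfree H G}"

text \<open>An \<open>r\<close>-subset of an \<open>(r+1)\<close>-set is the complement of a vertex, so for \<open>k \<le> r + 1\<close> the
  hypergraph is determined up to isomorphism by which \<open>k\<close> vertices are omitted by an edge. The two
  lemmas below confirm that this representative is the \<open>r\<close>-uniform hypergraph with \<open>r + 1\<close>
  vertices and \<open>k\<close> edges.\<close>

definition H_graph :: "nat \<Rightarrow> nat \<Rightarrow> nat hypergraph" where
  "H_graph r k = Hypergraph {..r} ((\<lambda>i. {..r} - {i}) ` {..<k})"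

lemma H_graph_props:
  assumes "k \<le> r + 1"
  shows "uniform r (H_graph r k)" "card (verts (H_graph r k)) = r + 1"
    "card (edges (H_graph r k)) = k"
proof -
  have "inj_on (\<lambda>i. {..r} - {i}) {..<k}"
  proof (rule inj_onI)
    fix i j
    assume "i \<in> {..<k}" and eq: "{..r} - {i} = {..r} - {j}"
    then have "i \<in> {..r}" using assms by simp
    then show "i = j" using eq by blast
  qed
  then show "card (edges (H_graph r k)) = k"
    by (simp add: H_graph_def card_image)
  have "card ({..r} - {i}) = r" if "i < k" for i
    using assms that by simp
  then show "uniform r (H_graph r k)" "card (verts (H_graph r k)) = r + 1"
    by (auto simp: uniform_def H_graph_def)
qed

lemma H_graph_unique:
  assumes "uniform r G" "card (verts G) = r + 1" "card (edges G) = k"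
  shows "isomorphic G (H_graph r k)"
proof -
  define V where "V = verts G"
  define c where "c = (\<lambda>v. V - {v})"
  define M where "M = {v\<in>V. c v \<in> edges G}"
  have fin: "finite V" and cV: "card V = r + 1"
    using assms by (auto simp: V_def uniform_def)
  have E: "edges G = c ` M"
  proof (intro equalityI subsetI)
    fix e assume e: "e \<in> edges G"
    then have sub: "e \<subseteq> V" and "card e = r"
      using assms(1) by (auto simp: uniform_def V_def)
    then have "card (V - e) = 1"
      using cV fin by (simp add: card_Diff_subset finite_subset)
    then obtain v where v: "V - e = {v}"
      by (auto simp: card_1_singleton_iff)
    then have "e = c v" "v \<in> V"
      using sub by (auto simp: c_def)
    then show "e \<in> c ` M"
      using e by (auto simp: M_def)
  qed (auto simp: M_def)
  have MV: "M \<subseteq> V" by (auto simp: M_def)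
  have "inj_on c M"
    using MV unfolding inj_on_def c_def by blast
  then have cM: "card M = k"
    using assms(3) E by (simp add: card_image)
  have kr: "k \<le> r + 1"
    using card_mono[OF fin MV] cV cM by simp
  obtain f where f: "bij_betw f M {..<k}"
    using finite_same_card_bij[of M "{..<k}"] cM finite_subset[OF MV fin] by auto
  have "card (V - M) = card {k..r}"
    using cV cM MV fin by (simp add: card_Diff_subset finite_subset)
  then obtain g where g: "bij_betw g (V - M) {k..r}"
    using finite_same_card_bij[of "V - M" "{k..r}"] fin by auto
  define h where "h = (\<lambda>v. if v \<in> M then f v else g v)"
  have hM: "bij_betw h M {..<k}"
    using f by (subst bij_betw_cong[of M h f]) (auto simp: h_def)
  have hN: "bij_betw h (V - M) {k..r}"
    using g by (subst bij_betw_cong[of "V - M" h g]) (auto simp: h_def)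
  have "bij_betw h (M \<union> (V - M)) ({..<k} \<union> {k..r})"
    by (rule bij_betw_combine[OF hM hN]) auto
  moreover have "M \<union> (V - M) = V" "{..<k} \<union> {k..r} = {..r}"
    using MV kr by auto
  ultimately have h: "bij_betw h V {..r}" by simp
  have hc: "h ` c v = {..r} - {h v}" if "v \<in> M" for v
  proof -
    have "h ` (V - {v}) = h ` V - h ` {v}"
      using h that MV by (intro inj_on_image_set_diff[of h V]) (auto simp: bij_betw_def)
    then show ?thesis
      using h by (simp add: c_def bij_betw_def)
  qed
  have "(\<lambda>e. h ` e) ` edges G = (\<lambda>v. {..r} - {h v}) ` M"
    unfolding E image_image by (rule image_cong) (simp_all add: hc)
  also have "\<dots> = (\<lambda>i. {..r} - {i}) ` (h ` M)"
    by (simp add: image_image)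
  also have "h ` M = {..<k}"
    using hM by (simp add: bij_betw_def)
  finally show ?thesis
    using h unfolding isomorphic_def H_graph_def V_def by auto
qed

end

theory Submission
  imports Defs
begin

text \<open>Replace every vertex of an extremal hypergraph \<open>G\<close> on \<open>n\<close> vertices by a class of \<open>t\<close> vertices,
  indexing the classes by the residues modulo \<open>n\<close>. Take all transversals of edges of \<open>G\<close>, and all
  \<open>r\<close>-sets that meet at most \<open>r - 2\<close> classes and whose elements sum to \<open>c\<close> modulo \<open>n\<close>. Let \<open>S\<close> be an
  \<open>(r+1)\<close>-set. If \<open>S\<close> is a transversal, it contains at most \<open>t\<close> edges because \<open>G\<close> is \<open>H\<close>-free.
  Otherwise the edges in \<open>S\<close> are all of the same kind, and the vertices they omit all lie in one
  class, so again there are at most \<open>t\<close> of them. Averaging over \<open>c\<close> yields the bound, since the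
  excluded \<open>r\<close>-sets meeting exactly \<open>r - 1\<close> classes number \<open>n (t choose 2) t^(r-2) (n-1 choose r-2)\<close>.\<close>

section \<open>Local sparsity and the Turan number\<close>

text \<open>If \<open>r + 1\<close> vertices span at least \<open>k\<close> edges, discarding the
  surplus leaves a copy by \<open>H_graph_unique\<close>; conversely, the vertices of a copy span at
  least \<open>k\<close> edges. Freeness thus becomes a local count, which is the form checked for
  the construction.\<close>

lemma hfree_H_graph_iff:
  assumes G: "uniform r G" and k: "0 < k" "k \<le> r + 1"
  shows "hfree (H_graph r k) G \<longleftrightarrow>
    (\<forall>S. S \<subseteq> verts G \<and> card S = r + 1 \<longrightarrow> card {e \<in> edges G. e \<subseteq> S} < k)"
proof
  assume free: "hfree (H_graph r k) G"
  show "\<forall>S. S \<subseteq> verts G \<and> card S = r + 1 \<longrightarrow> card {e \<in> edges G. e \<subseteq> S} < k"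
  proof (intro allI impI, rule ccontr)
    fix S assume S: "S \<subseteq> verts G \<and> card S = r + 1"
      and "\<not> card {e \<in> edges G. e \<subseteq> S} < k"
    then obtain E where E: "E \<subseteq> {e \<in> edges G. e \<subseteq> S}" "card E = k"
      by (meson not_less obtain_subset_with_card_n)
    have "uniform r (Hypergraph S E)"
      using G S E by (auto simp: uniform_def intro: finite_subset)
    then have "isomorphic (Hypergraph S E) (H_graph r k)"
      using S E by (intro H_graph_unique) auto
    moreover have "subhypergraph (Hypergraph S E) G"
      using S E by (auto simp: subhypergraph_def)
    ultimately show False using free by (auto simp: hfree_def)
  qed
next
  assume sparse: "\<forall>S. S \<subseteq> verts G \<and> card S = r + 1 \<longrightarrow> card {e \<in> edges G. e \<subseteq> S} < k"
  show "hfree (H_graph r k) G"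
    unfolding hfree_def
  proof clarify
    fix G' assume sub: "subhypergraph G' G" and "isomorphic G' (H_graph r k)"
    then obtain f where f: "bij_betw f (verts G') (verts (H_graph r k))"
      and im: "(\<lambda>e. f ` e) ` edges G' = edges (H_graph r k)"
      by (auto simp: isomorphic_def)
    have fin: "finite {e \<in> edges G. e \<subseteq> verts G'}"
      by (rule finite_subset[of _ "Pow (verts G)"]) (use G in \<open>auto simp: uniform_def\<close>)
    have sub': "edges G' \<subseteq> {e \<in> edges G. e \<subseteq> verts G'}"
      using sub by (auto simp: subhypergraph_def)
    have "k = card (edges (H_graph r k))"
      using H_graph_props(3)[OF k(2)] by simp
    also have "\<dots> \<le> card (edges G')"
      using im finite_subset[OF sub' fin] by (metis card_image_le)
    also have "\<dots> \<le> card {e \<in> edges G. e \<subseteq> verts G'}"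
      by (rule card_mono[OF fin sub'])
    finally have "k \<le> card {e \<in> edges G. e \<subseteq> verts G'}" .
    moreover have "card (verts G') = r + 1"
      using bij_betw_same_card[OF f] H_graph_props(2)[OF k(2)] by simp
    moreover have "verts G' \<subseteq> verts G"
      using sub by (simp add: subhypergraph_def)
    ultimately show False using sparse by (metis not_less)
  qed
qed

text \<open>There are infinitely many candidate hypergraphs on \<open>nat\<close>, but their edge
  counts are bounded by the number of subsets of the vertex set. \<open>Max\<close> is meaningful
  only for finite sets.\<close>

lemma finite_ex_candidates:
  "finite {card (edges G) | G :: nat hypergraph. uniform r G \<and> card (verts G) = n \<and> hfree H G}"
proof (rule finite_subset)
  show "{card (edges G) | G :: nat hypergraph. uniform r G \<and> card (verts G) = n \<and> hfree H G}
    \<subseteq> {..2 ^ n}"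
  proof (rule subsetI, elim CollectE exE conjE)
    fix m and G :: "nat hypergraph"
    assume G: "uniform r G" "card (verts G) = n" "m = card (edges G)"
    then have "card (edges G) \<le> card (Pow (verts G))"
      by (intro card_mono) (auto simp: uniform_def)
    then show "m \<in> {..2 ^ n}"
      using G by (simp add: card_Pow uniform_def)
  qed
qed simp

lemma card_edges_le_ex:
  fixes G :: "nat hypergraph"
  assumes "uniform r G" "card (verts G) = n" "hfree H G"
  shows "card (edges G) \<le> ex r n H"
  unfolding ex_def using assms by (intro Max_ge finite_ex_candidates) auto

lemma ex_H_graph_attained:
  assumes k: "0 < k" "k \<le> r + 1"
  obtains G :: "nat hypergraph" where "uniform r G" "card (verts G) = n"
    "hfree (H_graph r k) G" "card (edges G) = ex r n (H_graph r k)"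
proof -
  let ?C = "{card (edges G) | G :: nat hypergraph.
    uniform r G \<and> card (verts G) = n \<and> hfree (H_graph r k) G}"
  \<comment> \<open>The edgeless hypergraph makes the set of candidates nonempty; it is free because
    \<open>0 < k\<close>.\<close>
  have u: "uniform r (Hypergraph {..<n} {})" by (simp add: uniform_def)
  moreover from this have "hfree (H_graph r k) (Hypergraph {..<n} {})"
    using k by (simp add: hfree_H_graph_iff)
  ultimately have "card (edges (Hypergraph {..<n} {})) \<in> ?C"
    by (intro CollectI exI[of _ "Hypergraph {..<n} {}"]) auto
  then have "ex r n (H_graph r k) \<in> ?C"
    unfolding ex_def using finite_ex_candidates by (intro Max_in) auto
  then show thesis using that by auto
qed

section \<open>Counting sets with a prescribed shadow\<close>

text \<open>The map \<open>p\<close> sends a point to its class, so \<open>F\<close> is exactly the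
  set of classes met, and the excess of \<open>m\<close> over \<open>card F\<close> measures the
  distance from a transversal.\<close>

definition shadow_sets :: "('a \<Rightarrow> 'b) \<Rightarrow> 'a set \<Rightarrow> 'b set \<Rightarrow> nat \<Rightarrow> 'a set set" where
  "shadow_sets p X F m = {e. e \<subseteq> X \<and> p ` e = F \<and> card e = m}"

lemma finite_shadow_sets: "finite X \<Longrightarrow> finite (shadow_sets p X F m)"
  by (rule finite_subset[of _ "Pow X"]) (auto simp: shadow_sets_def)

text \<open>Split \<open>e\<close> into its points over \<open>i\<close> and the rest. The first
  piece is nonempty because \<open>i\<close> lies in the shadow, hence \<open>j\<close> starts at
  1.\<close>

lemma shadow_sets_insert:
  assumes X: "finite X" and i: "i \<notin> F"
  shows "shadow_sets p X (insert i F) m =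
    (\<Union>j\<in>{1..m}. (\<lambda>(a, b). a \<union> b) `
      ({a. a \<subseteq> {x\<in>X. p x = i} \<and> card a = j} \<times> shadow_sets p X F (m - j)))"
proof (intro equalityI subsetI)
  fix e assume e: "e \<in> shadow_sets p X (insert i F) m"
  define a where "a = {x\<in>e. p x = i}"
  have fin: "finite e"
    using e X by (auto simp: shadow_sets_def intro: finite_subset)
  have ae: "a \<subseteq> e" by (auto simp: a_def)
  have "i \<in> p ` e" using e by (auto simp: shadow_sets_def)
  then have "a \<noteq> {}" by (auto simp: a_def)
  then have j: "card a \<in> {1..m}"
    using fin ae e card_mono[OF fin ae] finite_subset[OF ae fin]
    by (auto simp: shadow_sets_def card_gt_0_iff Suc_le_eq)
  have "p ` (e - a) = p ` e - {i}" by (auto simp: a_def)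
  then have "p ` (e - a) = F" using e i by (auto simp: shadow_sets_def)
  then have "e - a \<in> shadow_sets p X F (m - card a)"
    using e ae fin by (auto simp: shadow_sets_def card_Diff_subset finite_subset)
  moreover have "a \<subseteq> {x\<in>X. p x = i}"
    using e by (auto simp: shadow_sets_def a_def)
  moreover have "e = a \<union> (e - a)" using ae by auto
  ultimately show "e \<in> (\<Union>j\<in>{1..m}. (\<lambda>(a, b). a \<union> b) `
      ({a. a \<subseteq> {x\<in>X. p x = i} \<and> card a = j} \<times> shadow_sets p X F (m - j)))"
    using j by (intro UN_I[of "card a"] image_eqI[of _ _ "(a, e - a)"]) auto
next
  fix e assume "e \<in> (\<Union>j\<in>{1..m}. (\<lambda>(a, b). a \<union> b) `
      ({a. a \<subseteq> {x\<in>X. p x = i} \<and> card a = j} \<times> shadow_sets p X F (m - j)))"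
  then obtain j a b where j: "1 \<le> j" "j \<le> m" and a: "a \<subseteq> {x\<in>X. p x = i}" "card a = j"
    and b: "b \<in> shadow_sets p X F (m - j)" and e: "e = a \<union> b"
    by auto
  have "a \<inter> b = {}" using a b i by (auto simp: shadow_sets_def)
  moreover have "finite a" "finite b"
    using a b X by (auto simp: shadow_sets_def intro: finite_subset)
  ultimately have "card e = m"
    using e a b j by (simp add: card_Un_disjoint shadow_sets_def)
  moreover have "a \<noteq> {}" using a j by auto
  then have "p ` a = {i}" using a by auto
  ultimately show "e \<in> shadow_sets p X (insert i F) m"
    using a b e by (auto simp: shadow_sets_def)
qed

lemma card_shadow_sets_insert:
  assumes X: "finite X" and i: "i \<notin> F" and fibre: "card {x\<in>X. p x = i} = t"
  shows "card (shadow_sets p X (insert i F) m) =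
    (\<Sum>j=1..m. (t choose j) * card (shadow_sets p X F (m - j)))"
proof -
  let ?A = "\<lambda>j. {a. a \<subseteq> {x\<in>X. p x = i} \<and> card a = j}"
  let ?B = "\<lambda>j. shadow_sets p X F (m - j)"
  \<comment> \<open>Filtering by class recovers both pieces from their union. This gives injectivity
    for a fixed \<open>j\<close> and disjointness for different \<open>j\<close>.\<close>
  have recover: "{x \<in> a \<union> b. p x = i} = a" "{x \<in> a \<union> b. p x \<noteq> i} = b"
    if "a \<in> ?A j" "b \<in> ?B j" for a b j
    using that i by (auto simp: shadow_sets_def)
  have inj: "inj_on (\<lambda>(a, b). a \<union> b) (?A j \<times> ?B j)" for j
  proof (rule inj_onI, clarify)
    fix a b a' b'
    assume *: "a \<subseteq> {x\<in>X. p x = i}" "b \<in> ?B (card a)" "a' \<subseteq> {x\<in>X. p x = i}"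
      "b' \<in> ?B (card a)" "card a' = card a" "a \<union> b = a' \<union> b'"
    have "a \<in> ?A (card a)" "a' \<in> ?A (card a)" using * by simp_all
    from recover[OF this(1) *(2)] recover[OF this(2) *(4)] *(6)
    show "a = a' \<and> b = b'" by metis
  qed
  have finA: "finite (?A j)" for j
    by (rule finite_subset[of _ "Pow X"]) (use X in auto)
  have disj: "(\<lambda>(a, b). a \<union> b) ` (?A j \<times> ?B j) \<inter> (\<lambda>(a, b). a \<union> b) ` (?A j' \<times> ?B j') = {}"
    if "j \<noteq> j'" for j j'
  proof (intro equals0I, elim IntE)
    fix e assume "e \<in> (\<lambda>(a, b). a \<union> b) ` (?A j \<times> ?B j)"
      "e \<in> (\<lambda>(a, b). a \<union> b) ` (?A j' \<times> ?B j')"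
    then obtain a b a' b' where *: "a \<in> ?A j" "b \<in> ?B j" "a' \<in> ?A j'" "b' \<in> ?B j'"
      "a \<union> b = a' \<union> b'"
      by (elim imageE SigmaE) (simp only: prod.case)
    have "a = a'" using recover(1)[OF *(1,2)] recover(1)[OF *(3,4)] *(5) by metis
    then show False using * that by simp
  qed
  have "card (shadow_sets p X (insert i F) m) =
      (\<Sum>j=1..m. card ((\<lambda>(a, b). a \<union> b) ` (?A j \<times> ?B j)))"
    unfolding shadow_sets_insert[OF X i]
    by (intro card_UN_disjoint ballI impI finite_imageI finite_cartesian_product finA
        finite_shadow_sets X disj) simp_all
  also have "\<dots> = (\<Sum>j=1..m. card (?A j) * card (?B j))"
    by (simp add: card_image[OF inj] card_cartesian_product)
  also have "\<dots> = (\<Sum>j=1..m. (t choose j) * card (?B j))"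
    using X fibre by (simp add: n_subsets)
  finally show ?thesis .
qed

lemma shadow_sets_empty_if_less:
  assumes "finite X" "m < card F"
  shows "shadow_sets p X F m = {}"
  using assms by (auto simp: shadow_sets_def) (meson card_image_le finite_subset not_less)

text \<open>With as many points as classes, taking two or more points over the new class leaves too
  few for the others, so only \<open>j = 1\<close> survives in the recurrence.\<close>

lemma card_shadow_sets_transversal:
  assumes X: "finite X" and F: "finite F" and fibre: "\<And>i. i \<in> F \<Longrightarrow> card {x\<in>X. p x = i} = t"
  shows "card (shadow_sets p X F (card F)) = t ^ card F"
  using F fibre
proof (induction F rule: finite_induct)
  case empty
  have "shadow_sets p X {} 0 = {{}}" by (auto simp: shadow_sets_def)
  then show ?case by simp
next
  case (insert i F)
  have zero: "card (shadow_sets p X F (Suc (card F) - j)) = 0" if "2 \<le> j" "j \<le> Suc (card F)" for j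
    using that shadow_sets_empty_if_less[OF X, of "Suc (card F) - j" F p] by simp
  have "card (shadow_sets p X (insert i F) (card (insert i F))) =
      (\<Sum>j=1..Suc (card F). (t choose j) * card (shadow_sets p X F (Suc (card F) - j)))"
    using insert by (simp add: card_shadow_sets_insert[OF X])
  also have "\<dots> = (\<Sum>j\<in>{1}. (t choose j) * card (shadow_sets p X F (Suc (card F) - j)))"
    using zero by (intro sum.mono_neutral_right) auto
  finally show ?case using insert by simp
qed

text \<open>Exactly one class contributes a pair and every other class a single point. In the
  recurrence, \<open>j = 1\<close> means that the pair lies over an old class, \<open>j = 2\<close>
  that it lies over the new one.\<close>

lemma card_shadow_sets_one_excess:
  assumes X: "finite X" and F: "finite F" and fibre: "\<And>i. i \<in> F \<Longrightarrow> card {x\<in>X. p x = i} = t"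
  shows "card (shadow_sets p X F (Suc (card F))) = card F * (t choose 2) * t ^ (card F - 1)"
  using F fibre
proof (induction F rule: finite_induct)
  case empty
  have "shadow_sets p X {} (Suc 0) = {}" by (auto simp: shadow_sets_def)
  then show ?case by simp
next
  case (insert i F)
  let ?m = "Suc (Suc (card F))"
  have zero: "card (shadow_sets p X F (?m - j)) = 0" if "3 \<le> j" "j \<le> ?m" for j
    using that shadow_sets_empty_if_less[OF X, of "?m - j" F p] by simp
  have "card (shadow_sets p X (insert i F) (Suc (card (insert i F)))) =
      (\<Sum>j=1..?m. (t choose j) * card (shadow_sets p X F (?m - j)))"
    using insert by (simp add: card_shadow_sets_insert[OF X])
  also have "\<dots> = (\<Sum>j\<in>{1, 2}. (t choose j) * card (shadow_sets p X F (?m - j)))"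
    using zero by (intro sum.mono_neutral_right) auto
  also have "\<dots> = t * card (shadow_sets p X F (Suc (card F))) +
      (t choose 2) * card (shadow_sets p X F (card F))"
    by (simp add: numeral_2_eq_2)
  also have "\<dots> = t * (card F * (t choose 2) * t ^ (card F - 1)) + (t choose 2) * t ^ card F"
    using insert card_shadow_sets_transversal[OF X, of F p t] by simp
  \<comment> \<open>The case split handles the truncated exponent \<open>card F - 1\<close>: for
    empty \<open>F\<close> its term carries the factor 0.\<close>
  also have "\<dots> = Suc (card F) * (t choose 2) * t ^ card F"
    by (cases "card F") (auto simp: algebra_simps)
  finally show ?case using insert by simp
qed

lemma card_sets_by_shadow:
  assumes X: "finite X" and FF: "finite FF"
    and N: "\<And>F. F \<in> FF \<Longrightarrow> card (shadow_sets p X F m) = N"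
  shows "card {e. e \<subseteq> X \<and> card e = m \<and> p ` e \<in> FF} = card FF * N"
proof -
  have "{e. e \<subseteq> X \<and> card e = m \<and> p ` e \<in> FF} = (\<Union>F\<in>FF. shadow_sets p X F m)"
    by (auto simp: shadow_sets_def)
  also have "card \<dots> = (\<Sum>F\<in>FF. card (shadow_sets p X F m))"
    using FF finite_shadow_sets[OF X] by (intro card_UN_disjoint) (auto simp: shadow_sets_def)
  finally show ?thesis using N by simp
qed

text \<open>Applied both to the family of all \<open>r\<close>-subsets of \<open>V\<close> and to
  the edge set of the extremal hypergraph.\<close>

lemma card_sets_transversal_shadow:
  assumes X: "finite X" and V: "finite V" and fibre: "\<And>i. i \<in> V \<Longrightarrow> card {x\<in>X. p x = i} = t"
    and FF: "\<And>F. F \<in> FF \<Longrightarrow> F \<subseteq> V \<and> card F = r"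
  shows "card {e. e \<subseteq> X \<and> card e = r \<and> p ` e \<in> FF} = card FF * t ^ r"
proof (rule card_sets_by_shadow[OF X])
  show "finite FF" by (rule finite_subset[of _ "Pow V"]) (use V FF in auto)
  fix F assume "F \<in> FF"
  then have "F \<subseteq> V" "card F = r" using FF by auto
  then show "card (shadow_sets p X F r) = t ^ r"
    using card_shadow_sets_transversal[OF X, of F p t] fibre V finite_subset by blast
qed

text \<open>The \<open>r\<close>-subsets of \<open>X\<close> are sorted by whether they meet
  \<open>r\<close>, \<open>r - 1\<close> or at most \<open>r - 2\<close> classes.\<close>

lemma choose_split_by_shadow_size:
  assumes X: "finite X" and V: "finite V" "p ` X \<subseteq> V" "card V = n" "1 \<le> n"
    and fibre: "\<And>i. i \<in> V \<Longrightarrow> card {x\<in>X. p x = i} = t" and r: "2 \<le> r"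
  shows "card X choose r = (n choose r) * t ^ r
      + n * ((n - 1) choose (r - 2)) * (t choose 2) * t ^ (r - 2)
      + card {e. e \<subseteq> X \<and> card e = r \<and> card (p ` e) + 2 \<le> r}"
proof -
  let ?FF = "\<lambda>s. {F. F \<subseteq> V \<and> card F = s}"
  let ?Q = "\<lambda>s. {e. e \<subseteq> X \<and> card e = r \<and> p ` e \<in> ?FF s}"
  let ?R = "{e. e \<subseteq> X \<and> card e = r \<and> card (p ` e) + 2 \<le> r}"
  have fin: "finite {e. e \<subseteq> X \<and> P e}" for P
    by (rule finite_subset[of _ "Pow X"]) (use X in auto)
  have "{e. e \<subseteq> X \<and> card e = r} = (?Q r \<union> ?Q (r - 1)) \<union> ?R"
  proof (intro equalityI subsetI)
    fix e assume e: "e \<in> {e. e \<subseteq> X \<and> card e = r}"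
    then have "card (p ` e) \<le> r"
      using X by (metis (mono_tags) card_image_le finite_subset mem_Collect_eq)
    then have "card (p ` e) = r \<or> card (p ` e) = r - 1 \<or> card (p ` e) + 2 \<le> r" by linarith
    moreover have "p ` e \<subseteq> V" using e V by auto
    ultimately show "e \<in> (?Q r \<union> ?Q (r - 1)) \<union> ?R" using e by auto
  qed auto
  then have "card X choose r = card ((?Q r \<union> ?Q (r - 1)) \<union> ?R)"
    using n_subsets[OF X, of r] by simp
  also have "\<dots> = card (?Q r) + card (?Q (r - 1)) + card ?R"
    using r fin by (subst card_Un_disjoint, auto)+
  also have "card (?Q r) = (n choose r) * t ^ r"
    using card_sets_transversal_shadow[OF X V(1) fibre, of "?FF r" r] V by (simp add: n_subsets)
  also have "card (?Q (r - 1)) = card (?FF (r - 1)) * ((r - 1) * (t choose 2) * t ^ (r - 2))"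
  proof (rule card_sets_by_shadow[OF X])
    show "finite (?FF (r - 1))" using V by simp
    fix F assume F: "F \<in> ?FF (r - 1)"
    then have "card (shadow_sets p X F (Suc (card F))) = card F * (t choose 2) * t ^ (card F - 1)"
      using V(1) fibre by (intro card_shadow_sets_one_excess[OF X]) (auto intro: finite_subset)
    then show "card (shadow_sets p X F r) = (r - 1) * (t choose 2) * t ^ (r - 2)"
      using F r by (simp add: numeral_2_eq_2)
  qed
  also have "card (?FF (r - 1)) = n choose (r - 1)"
    using V by (simp add: n_subsets)
  also have "(n choose (r - 1)) * ((r - 1) * (t choose 2) * t ^ (r - 2)) =
      n * ((n - 1) choose (r - 2)) * (t choose 2) * t ^ (r - 2)"
  proof -
    obtain s where s: "r = Suc (Suc s)" using r by (metis Suc_le_D numeral_2_eq_2 Suc_le_mono)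
    obtain n' where n': "n = Suc n'" using V(4) by (cases n) auto
    \<comment> \<open>Absorption identity; it extracts the factor \<open>n\<close> that later
      cancels against the averaging over \<open>n\<close> residues.\<close>
    have "(n choose (r - 1)) * (r - 1) = n * ((n - 1) choose (r - 2))"
      using Suc_times_binomial_eq[of n' s] s n' by simp
    then show ?thesis by (metis mult.assoc)
  qed
  finally show ?thesis .
qed

section \<open>The construction\<close>

lemma card_residue_class:
  fixes i n t :: nat
  assumes "i < n"
  shows "card {x\<in>{..<t * n}. x mod n = i} = t"
proof -
  have "{x\<in>{..<t * n}. x mod n = i} = (\<lambda>j. j * n + i) ` {..<t}"
  proof (intro equalityI subsetI)
    fix x assume x: "x \<in> {x\<in>{..<t * n}. x mod n = i}"
    then have "x = (x div n) * n + i" by (metis (mono_tags) div_mult_mod_eq mem_Collect_eq)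
    moreover have "x div n < t" using x by (simp add: less_mult_imp_div_less)
    ultimately show "x \<in> (\<lambda>j. j * n + i) ` {..<t}" by auto
  next
    fix x assume "x \<in> (\<lambda>j. j * n + i) ` {..<t}"
    then obtain j where j: "j < t" "x = j * n + i" by auto
    have "x < Suc j * n" using j assms by simp
    also have "\<dots> \<le> t * n" using j(1) by (intro mult_le_mono1) simp
    finally show "x \<in> {x\<in>{..<t * n}. x mod n = i}" using j assms by simp
  qed
  moreover have "inj_on (\<lambda>j. j * n + i) {..<t}" using assms by (auto simp: inj_on_def)
  ultimately show ?thesis by (simp add: card_image)
qed

text \<open>The level sets of \<open>g\<close> partition \<open>Q\<close> into \<open>n\<close>
  parts, which cannot all be smaller than the average. Multiplying by \<open>n\<close> avoids
  division in \<open>nat\<close>.\<close>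

lemma pigeonhole_average:
  fixes g :: "'a \<Rightarrow> nat"
  assumes Q: "finite Q" and n: "1 \<le> n" and g: "\<And>x. x \<in> Q \<Longrightarrow> g x < n"
  obtains c where "c < n" "card Q \<le> n * card {x\<in>Q. g x = c}"
proof -
  have "\<exists>c<n. card Q \<le> n * card {x\<in>Q. g x = c}"
  proof (rule ccontr)
    assume "\<not> ?thesis"
    then have less: "n * card {x\<in>Q. g x = c} < card Q" if "c < n" for c
      using that by (simp add: not_le)
    have "Q = (\<Union>c\<in>{..<n}. {x\<in>Q. g x = c})" using g by auto
    then have "card Q = card (\<Union>c\<in>{..<n}. {x\<in>Q. g x = c})" by simp
    also have "\<dots> = (\<Sum>c<n. card {x\<in>Q. g x = c})"
      using Q by (intro card_UN_disjoint) auto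
    finally have "n * card Q = (\<Sum>c<n. n * card {x\<in>Q. g x = c})"
      by (simp add: sum_distrib_left)
    also have "\<dots> < (\<Sum>c<n. card Q)"
      using n less by (intro sum_strict_mono) (auto simp: lessThan_empty_iff)
    finally show False by simp
  qed
  then show thesis using that by auto
qed

text \<open>Sets meeting exactly \<open>r - 1\<close> classes are left out on purpose: the gap keeps
  the two kinds of edges from occurring in a common \<open>(r+1)\<close>-set when the members of
  \<open>E\<close> have size \<open>r\<close>.\<close>

definition blowup_edges :: "nat \<Rightarrow> nat \<Rightarrow> nat \<Rightarrow> (nat \<Rightarrow> 'a) \<Rightarrow> 'a set set \<Rightarrow> nat \<Rightarrow> nat set set" where
  "blowup_edges r t n p E c =
     {e. e \<subseteq> {..<t * n} \<and> card e = r \<and> p ` e \<in> E} \<union>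
     {e. e \<subseteq> {..<t * n} \<and> card e = r \<and> card (p ` e) + 2 \<le> r \<and> \<Sum>e mod n = c}"

text \<open>The omitted vertex is the total of \<open>S\<close> minus the sum of what remains. The
  computation is done in \<open>int\<close> because subtraction in \<open>nat\<close>
  truncates.\<close>

lemma omitted_same_residue:
  fixes S :: "nat set"
  assumes S: "finite S" "v \<in> S" "w \<in> S" and eq: "\<Sum>(S - {v}) mod n = \<Sum>(S - {w}) mod n"
  shows "v mod n = w mod n"
proof -
  have "int (\<Sum>(S - {v})) = int (\<Sum>S) - int v" "int (\<Sum>(S - {w})) = int (\<Sum>S) - int w"
    using sum.remove[OF S(1,2), of int] sum.remove[OF S(1,3), of int] by simp_all
  moreover have "int (\<Sum>(S - {v})) mod int n = int (\<Sum>(S - {w})) mod int n"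
    using eq by (metis zmod_int)
  ultimately have "(int (\<Sum>S) - int v) mod int n = (int (\<Sum>S) - int w) mod int n" by simp
  then have "(int (\<Sum>S) - (int (\<Sum>S) - int v)) mod int n =
      (int (\<Sum>S) - (int (\<Sum>S) - int w)) mod int n"
    by (rule mod_diff_cong[OF refl])
  then show ?thesis by (simp flip: zmod_int)
qed

text \<open>The classes are unions of residue classes by \<open>pmod\<close>, so fixing the sum
  modulo \<open>n\<close> fixes the class of the omitted vertex; a class has only \<open>t\<close>
  points.\<close>

lemma blowup_locally_sparse:
  assumes fibre: "\<And>i. i \<in> p ` {..<t * n} \<Longrightarrow> card {x\<in>{..<t * n}. p x = i} = t"
    and pmod: "\<And>x y. x mod n = y mod n \<Longrightarrow> p x = p y"
    and E: "finite E" "\<And>f. f \<in> E \<Longrightarrow> card f = r"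
    and sparse: "\<And>T. T \<subseteq> p ` {..<t * n} \<Longrightarrow> card T = r + 1 \<Longrightarrow> card {f\<in>E. f \<subseteq> T} \<le> t"
    and S: "S \<subseteq> {..<t * n}" "card S = r + 1"
  shows "card {e \<in> blowup_edges r t n p E c. e \<subseteq> S} \<le> t"
proof -
  let ?B = "{e \<in> blowup_edges r t n p E c. e \<subseteq> S}"
  have finS: "finite S" using S finite_subset by blast
  show ?thesis
  proof (cases "inj_on p S")
    case True
    \<comment> \<open>Every edge inside such an \<open>S\<close> meets \<open>r\<close> classes,
      hence is of the first kind, and \<open>p\<close> maps these edges injectively to members of
      \<open>E\<close> inside the image of \<open>S\<close>.\<close>
    have inj: "inj_on ((`) p) ?B"
      using True by (auto simp: inj_on_def inj_on_image_eq_iff)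
    have "(`) p ` ?B \<subseteq> {f\<in>E. f \<subseteq> p ` S}"
    proof clarify
      fix e assume e: "e \<in> blowup_edges r t n p E c" "e \<subseteq> S"
      have "card (p ` e) = card e"
        using True e by (intro card_image) (auto intro: inj_on_subset)
      then show "p ` e \<in> E \<and> p ` e \<subseteq> p ` S"
        using e by (auto simp: blowup_edges_def)
    qed
    then have "card ?B \<le> card {f\<in>E. f \<subseteq> p ` S}"
      using inj E(1) by (intro card_inj_on_le[of "(`) p"]) auto
    also have "\<dots> \<le> t"
      using S True by (intro sparse image_mono) (simp_all add: card_image)
    finally show ?thesis .
  next
    case False
    then obtain x y where xy: "x \<in> S" "y \<in> S" "x \<noteq> y" "p x = p y" by (auto simp: inj_on_def)
    \<comment> \<open>An edge in \<open>S\<close> omits exactly one vertex. \<open>D\<close>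
      collects the omitted vertices, so it suffices to place \<open>D\<close> in one class.\<close>
    define D where "D = {v\<in>S. S - {v} \<in> blowup_edges r t n p E c}"
    have BD: "?B = (\<lambda>v. S - {v}) ` D"
    proof (intro equalityI subsetI)
      fix e assume e: "e \<in> ?B"
      then have "card e = r" by (auto simp: blowup_edges_def)
      then have "card (S - e) = 1"
        using e S finS by (auto simp: card_Diff_subset finite_subset)
      then obtain v where "S - e = {v}" by (auto simp: card_1_singleton_iff)
      then have "v \<in> S" "e = S - {v}" using e by auto
      then show "e \<in> (\<lambda>v. S - {v}) ` D" using e by (auto simp: D_def)
    qed (auto simp: D_def)
    \<comment> \<open>A transversal cannot contain both \<open>x\<close> and \<open>y\<close>, which
      share a class, so it omits one of them.\<close>
    have transversal: "v \<in> {x, y}" if "v \<in> S" "p ` (S - {v}) \<in> E" for v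
    proof (rule ccontr)
      assume "v \<notin> {x, y}"
      moreover have "card (p ` (S - {v})) = card (S - {v})"
        using that E S by simp
      then have "inj_on p (S - {v})" using finS by (simp add: eq_card_imp_inj_on)
      ultimately show False using xy by (auto simp: inj_on_def)
    qed
    \<comment> \<open>Restoring \<open>w\<close> adds at most one class, while the two kinds of
      edges differ by at least two classes.\<close>
    have no_mix: False if "v \<in> S" "p ` (S - {v}) \<in> E" "w \<in> S" "card (p ` (S - {w})) + 2 \<le> r" for v w
    proof -
      have "r = card (p ` (S - {v}))" using that E by simp
      also have "\<dots> \<le> card (insert (p w) (p ` (S - {w})))"
        using finS by (intro card_mono) auto
      also have "\<dots> \<le> Suc (card (p ` (S - {w})))" by (rule card_insert_le_m1) auto
      finally show False using that by simp
    qed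
    have same: "p v = p w" if v: "v \<in> D" and w: "w \<in> D" for v w
    proof -
      have vw: "v \<in> S" "w \<in> S" using v w by (auto simp: D_def)
      consider "p ` (S - {v}) \<in> E" "p ` (S - {w}) \<in> E"
        | "card (p ` (S - {v})) + 2 \<le> r" "card (p ` (S - {w})) + 2 \<le> r"
          "\<Sum>(S - {v}) mod n = \<Sum>(S - {w}) mod n"
        using v w no_mix vw by (auto simp: D_def blowup_edges_def)
      then show ?thesis
      proof cases
        case 1
        then have "v \<in> {x, y}" "w \<in> {x, y}" using transversal vw by blast+
        then show ?thesis using xy by auto
      next
        case 2
        then show ?thesis using omitted_same_residue[OF finS vw] pmod by blast
      qed
    qed
    show ?thesis
    proof (cases "D = {}")
      case True
      then show ?thesis unfolding BD by simp
    next
      case False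
      then obtain v where v: "v \<in> D" by auto
      have "card ?B \<le> card D"
        unfolding BD using finS by (intro card_image_le) (auto simp: D_def)
      also have "\<dots> \<le> card {x\<in>{..<t * n}. p x = p v}"
        using same[OF _ v] S by (intro card_mono) (auto simp: D_def)
      also have "\<dots> = t" using v S by (intro fibre) (auto simp: D_def)
      finally show ?thesis .
    qed
  qed
qed

theorem theorem11:
  fixes r k n t :: nat
  assumes "r \<ge> 2" and "2 \<le> k" and "k \<le> r + 1" and "n \<ge> 1" and "t = k - 1"
  shows "real (ex r (t * n) (H_graph r k)) \<ge>
           real t ^ r * real (ex r n (H_graph r k))
           + 1 / real n * real ((t * n) choose r)
           - 1 / real n * real t ^ r * real (n choose r)
           - 1 / 2 * real t ^ (r - 1) * (real t - 1) * real ((n - 1) choose (r - 2))"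
proof -
  have k: "0 < k" using assms by simp
  obtain G :: "nat hypergraph" where G: "uniform r G" "card (verts G) = n"
    "hfree (H_graph r k) G" "card (edges G) = ex r n (H_graph r k)"
    using ex_H_graph_attained[OF k assms(3)] .
  define V where "V = verts G"
  define E where "E = edges G"
  have V: "finite V" "card V = n" and E: "\<And>f. f \<in> E \<Longrightarrow> f \<subseteq> V \<and> card f = r"
    using G by (auto simp: uniform_def V_def E_def)
  have finE: "finite E" by (rule finite_subset[of _ "Pow V"]) (use V E in auto)
  \<comment> \<open>The vertices of \<open>G\<close> are arbitrary naturals; \<open>\<phi>\<close>
    relabels them by residues, so that the fibres of \<open>p\<close> are the residue classes modulo
    \<open>n\<close>.\<close>
  obtain \<phi> where \<phi>: "bij_betw \<phi> {..<n} V"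
    using finite_same_card_bij[of "{..<n}" V] V by auto
  define p where "p x = \<phi> (x mod n)" for x
  define X where "X = {..<t * n}"
  have fibre: "card {x\<in>X. p x = i} = t" if "i \<in> V" for i
  proof -
    obtain j where j: "j < n" "i = \<phi> j" using \<phi> \<open>i \<in> V\<close> by (auto simp: bij_betw_def)
    have "p x = i \<longleftrightarrow> x mod n = j" for x
      using j \<phi> assms(4) by (auto simp: p_def bij_betw_def inj_on_def)
    then show ?thesis using card_residue_class[OF j(1)] by (simp add: X_def)
  qed
  have pX: "p ` X \<subseteq> V" using \<phi> assms(4) by (auto simp: p_def bij_betw_def)
  define Q where "Q = {e. e \<subseteq> X \<and> card e = r \<and> card (p ` e) + 2 \<le> r}"
  have finX: "finite X" by (simp add: X_def)
  have finQ: "finite Q" by (rule finite_subset[of _ "Pow X"]) (use finX in \<open>auto simp: Q_def\<close>)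
  obtain c where c: "card Q \<le> n * card {e\<in>Q. \<Sum>e mod n = c}"
    using pigeonhole_average[OF finQ assms(4), of "\<lambda>e. \<Sum>e mod n"] assms(4) by auto
  define B where "B = blowup_edges r t n p E c"
  let ?T = "{e. e \<subseteq> X \<and> card e = r \<and> p ` e \<in> E}"
  have B: "B = ?T \<union> {e\<in>Q. \<Sum>e mod n = c}"
    by (auto simp: B_def blowup_edges_def X_def Q_def)
  have uni: "uniform r (Hypergraph X B)" using finX by (auto simp: uniform_def B Q_def)
  have "card {f\<in>E. f \<subseteq> T} < k" if "T \<subseteq> V" "card T = r + 1" for T
    using that G(3) unfolding hfree_H_graph_iff[OF G(1) k assms(3)] V_def E_def by blast
  then have "card {f\<in>E. f \<subseteq> T} \<le> t" if "T \<subseteq> V" "card T = r + 1" for T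
    using that assms(5) by (metis Suc_pred' k less_Suc_eq_le One_nat_def)
  then have "card {e\<in>B. e \<subseteq> S} \<le> t" if "S \<subseteq> X" "card S = r + 1" for S
    unfolding B_def using that fibre E finE pX
    by (intro blowup_locally_sparse) (auto simp: X_def p_def)
  then have "card {e\<in>B. e \<subseteq> S} < k" if "S \<subseteq> X" "card S = r + 1" for S
    using that assms(5) by (metis Suc_pred' k less_Suc_eq_le One_nat_def)
  then have "hfree (H_graph r k) (Hypergraph X B)"
    unfolding hfree_H_graph_iff[OF uni k assms(3)] by simp
  then have le: "card B \<le> ex r (t * n) (H_graph r k)"
    using card_edges_le_ex[OF uni, of "t * n"] by (simp add: X_def)
  \<comment> \<open>The union is disjoint: the image of a set in \<open>?T\<close> has
    \<open>r\<close> elements, that of a set in \<open>Q\<close> at most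
    \<open>r - 2\<close>.\<close>
  have "card B = card ?T + card {e\<in>Q. \<Sum>e mod n = c}"
    unfolding B using finX finQ assms(1) E
    by (intro card_Un_disjoint) (auto simp: Q_def)
  also have "card ?T = card E * t ^ r"
    using card_sets_transversal_shadow[OF finX V(1) fibre E] .
  finally have cB: "card B = card E * t ^ r + card {e\<in>Q. \<Sum>e mod n = c}" .
  have cE: "card E = ex r n (H_graph r k)" using G(4) by (simp add: E_def)
  define b where "b = (n - 1) choose (r - 2)"
  have count: "(t * n) choose r =
      (n choose r) * t ^ r + n * b * (t choose 2) * t ^ (r - 2) + card Q"
    using choose_split_by_shadow_size[OF finX V(1) pX V(2) assms(4) fibre assms(1)]
    by (simp add: X_def Q_def b_def)
  \<comment> \<open>Turns the count of the excluded sets, up to the factor \<open>n * b\<close>,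
    into the last term of the bound.\<close>
  have pair: "real (t choose 2) * real t ^ (r - 2) = 1 / 2 * real t ^ (r - 1) * (real t - 1)"
  proof -
    obtain s where s: "r = Suc (Suc s)" using assms(1) by (metis Suc_le_D numeral_2_eq_2 Suc_le_mono)
    have "even (t * (t - 1))" by (cases t) auto
    then have "2 * (t choose 2) = t * (t - 1)" by (simp only: choose_two dvd_mult_div_cancel)
    then have "real (2 * (t choose 2)) = real (t * (t - 1))" by (simp only:)
    then have "2 * real (t choose 2) = real t * (real t - 1)"
      using assms(2,5) by (simp add: of_nat_diff)
    then have "real (t choose 2) = real t * (real t - 1) / 2" by simp
    then show ?thesis using s by simp
  qed
  have n0: "real n > 0" using assms by simp
  \<comment> \<open>Solving \<open>count\<close> for \<open>card Q\<close>; dividing by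
    \<open>n\<close> afterwards leaves the last term free of \<open>1 / n\<close>.\<close>
  have "real ((t * n) choose r) - real t ^ r * real (n choose r)
      - real n * (1 / 2 * real t ^ (r - 1) * (real t - 1) * real b) = real (card Q)"
    unfolding count pair[symmetric] by (simp add: algebra_simps)
  also have "\<dots> \<le> real n * real (card {e\<in>Q. \<Sum>e mod n = c})"
    using c by (simp flip: of_nat_mult)
  finally have "(real ((t * n) choose r) - real t ^ r * real (n choose r)
      - real n * (1 / 2 * real t ^ (r - 1) * (real t - 1) * real b)) / real n
      \<le> real (card {e\<in>Q. \<Sum>e mod n = c})"
    using n0 by (simp add: pos_divide_le_eq mult.commute)
  also have "\<dots> = real (card B) - real t ^ r * real (ex r n (H_graph r k))"
    using cB cE by simp
  also have "\<dots> \<le> real (ex r (t * n) (H_graph r k)) - real t ^ r * real (ex r n (H_graph r k))"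
    using le by simp
  finally show ?thesis using n0 unfolding b_def by (simp add: diff_divide_distrib)
qed

end
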